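(* Let $(\Omega,\mathcal{F},\mathbb{P})$ be a probability space, let $\theta>0$, and let $\mathcal{A}$ be a closed subset of $L^2(\mathbb{P})$. Suppose that the problems $\max_{X_T\in\mathcal{A}}U_\theta(X_T)$ and $\max_{X_T\in\mathcal{A}}V_\theta(X_T)$ have finite optimal values, and let $X_T^*\in\mathcal{A}$ be an optimally invested wealth for the first problem, i.e. $U_\theta(X_T^* )=\max_{X_T\in\mathcal{A}}U_\theta(X_T)$. (i) If $1-\theta\left(X_T^*-\mathbb{E}[X_T^*]\right)\in L^2_+(\mathbb{P})\cap\mathcal{M}(x_0)$ for some $x_0\in\mathbb{R}$, then the two optimal values are the same: $$\max_{X_T\in\mathcal{A}}U_\theta(X_T)=\max_{X_T\in\mathcal{A}}V_\theta(X_T).$$ (ii) If $1-\theta\left(X_T^*-\mathbb{E}[X_T^*]\right)\notin L^2_+(\mathbb{P})$, then the two optimal values are different: $$\max_{X_T\in\mathcal{A}}U_\theta(X_T)<\max_{X_T\in\mathcal{A}}V_\theta(X_T).$$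
   Context: $\mathbb{E}$ denotes expectation under $\mathbb{P}$. $\max$ denotes the optimal value (supremum) of the problem. Mean-variance preference: $U_\theta(X)=\mathbb{E}[X]-\frac{\theta}{2}\mathrm{Var}(X)$ for $X\in L^2(\mathbb{P})$. Monotone mean-variance preference: for $X\in L^2(\mathbb{P})$, $$V_\theta(X)=\inf_{\mathbb{Q}\in\Delta^2(\mathbb{P})}\left\{\mathbb{E}^{\mathbb{Q}}[X]+\frac{1}{2\theta}\left(\mathbb{E}\left[\left(\frac{\mathrm{d}\mathbb{Q}}{\mathrm{d}\mathbb{P}}\right)^2\right]-1\right)\right\},$$ where $\Delta^2(\mathbb{P})$ is the set of probability measures $\mathbb{Q}\ll\mathbb{P}$ with $\mathbb{E}\left[\left(\mathrm{d}\mathbb{Q}/\mathrm{d}\mathbb{P}\right)^2\right]<\infty$. $L^2_+(\mathbb{P})=\{g\in L^2(\mathbb{P}):g\geq 0\ \mathbb{P}\text{-a.s.}\}$. For $x_0\in\mathbb{R}$, the set of (signed) discounting measures is $$\mathcal{M}(x_0)=\left\{g\in L^2(\mathbb{P}):\mathbb{E}[g]=1,\ \mathbb{E}[gX_T]=x_0\ \text{for all } X_T\in\mathcal{A}\right\}.$$ *)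

theory Defs
  imports "HOL-Probability.Probability"
begin

text \<open>Elements of \<open>L\<^sup>2\<close> are represented by functions, not by classes modulo
  almost-sure equality.\<close>

definition L2 :: "'a measure \<Rightarrow> ('a \<Rightarrow> real) set" where
  "L2 M = {X \<in> borel_measurable M. integrable M (\<lambda>w. (X w)\<^sup>2)}"

definition L2_plus :: "'a measure \<Rightarrow> ('a \<Rightarrow> real) set" where
  "L2_plus M = {g \<in> L2 M. AE w in M. 0 \<le> g w}"

text \<open>Sequential closedness in the \<open>L\<^sup>2\<close> seminorm. Constant sequences show that a closed
  set is stable under almost-sure equality within \<open>L2 M\<close>, so that it corresponds to a subset of
  the quotient space.\<close>

definition L2_closed :: "'a measure \<Rightarrow> ('a \<Rightarrow> real) set \<Rightarrow> bool" where
  "L2_closed M A \<longleftrightarrow>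
     A \<subseteq> L2 M \<and>
     (\<forall>Xs X. (\<forall>n::nat. Xs n \<in> A) \<longrightarrow> X \<in> L2 M \<longrightarrow>
        (\<lambda>n. \<integral>w. (Xs n w - X w)\<^sup>2 \<partial>M) \<longlonglongrightarrow> 0 \<longrightarrow> X \<in> A)"

definition mean_variance :: "'a measure \<Rightarrow> real \<Rightarrow> ('a \<Rightarrow> real) \<Rightarrow> real" where
  "mean_variance M \<theta> X =
     prob_space.expectation M X - \<theta> / 2 * prob_space.variance M X"

definition density_second_moment :: "'a measure \<Rightarrow> 'a measure \<Rightarrow> ennreal" where
  "density_second_moment M Q = (\<integral>\<^sup>+w. (RN_deriv M Q w)\<^sup>2 \<partial>M)"

definition Delta2 :: "'a measure \<Rightarrow> 'a measure set" where
  "Delta2 M = {Q. prob_space Q \<and> sets Q = sets M \<and> absolutely_continuous M Q \<and>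
                  density_second_moment M Q < \<infinity>}"

text \<open>The infimum is taken in the extended reals, so that no boundedness is presupposed.\<close>

definition monotone_mean_variance :: "'a measure \<Rightarrow> real \<Rightarrow> ('a \<Rightarrow> real) \<Rightarrow> ereal" where
  "monotone_mean_variance M \<theta> X =
     (INF Q\<in>Delta2 M. ereal (prob_space.expectation Q X +
        1 / (2 * \<theta>) * (enn2real (density_second_moment M Q) - 1)))"

definition discounting_measures ::
  "'a measure \<Rightarrow> ('a \<Rightarrow> real) set \<Rightarrow> real \<Rightarrow> ('a \<Rightarrow> real) set" where
  "discounting_measures M A x0 =
     {g \<in> L2 M. prob_space.expectation M g = 1 \<and>
        (\<forall>X\<in>A. prob_space.expectation M (\<lambda>w. g w * X w) = x0)}"

end

theory Submission
  imports Defs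
begin

text \<open>Completing the square in the density \<open>Z\<close> of a measure \<open>Q\<close> shows that the penalised
  expectation of \<open>X\<close> under \<open>Q\<close> exceeds the mean-variance utility of \<open>X\<close> by
  \<open>1 / (2 * \<theta>)\<close> times the squared \<open>L\<^sup>2\<close> distance from \<open>Z\<close> to \<open>W = 1 - \<theta> * (X - E X)\<close>.
  Hence the monotone utility dominates the mean-variance utility. If \<open>W\<close> for the optimal wealth
  is itself a density that prices all of \<open>A\<close> equally, then using it as \<open>Z\<close> bounds the monotone
  utility on all of \<open>A\<close> by the optimal mean-variance utility. If \<open>W\<close> is negative on a set of positive
  measure, its distance to nonnegative functions is at least the norm of its negative part,
  which gives the strict inequality already at the optimal wealth.\<close>

lemma L2_measurable: "X \<in> L2 M \<Longrightarrow> X \<in> borel_measurable M"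
  by (simp add: L2_def)

lemma L2_integrable_square: "X \<in> L2 M \<Longrightarrow> integrable M (\<lambda>w. (X w)\<^sup>2)"
  by (simp add: L2_def)

text \<open>The elementary bound |a * b| <= a^2 + b^2 supplies an integrable majorant.\<close>

lemma L2_integrable_mult:
  assumes X: "X \<in> L2 M" and Y: "Y \<in> L2 M"
  shows "integrable M (\<lambda>w. X w * Y w)"
proof (rule Bochner_Integration.integrable_bound)
  show "integrable M (\<lambda>w. (X w)\<^sup>2 + (Y w)\<^sup>2)"
    using X Y by (simp add: L2_def)
  show "(\<lambda>w. X w * Y w) \<in> borel_measurable M"
    using X Y by (intro borel_measurable_times L2_measurable)
  have "\<bar>a * b\<bar> \<le> a\<^sup>2 + b\<^sup>2" for a b :: real
    using sum_squares_bound[of "\<bar>a\<bar>" "\<bar>b\<bar>"] abs_ge_zero[of "a * b"] unfolding power2_abs abs_mult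
    by linarith
  then show "AE w in M. norm (X w * Y w) \<le> norm ((X w)\<^sup>2 + (Y w)\<^sup>2)"
    by (simp del: abs_mult)
qed

lemma L2_scale: "X \<in> L2 M \<Longrightarrow> (\<lambda>w. c * X w) \<in> L2 M"
  by (auto simp: L2_def power_mult_distrib)

lemma L2_add:
  assumes "X \<in> L2 M" "Y \<in> L2 M"
  shows "(\<lambda>w. X w + Y w) \<in> L2 M"
proof -
  have "integrable M (\<lambda>w. (X w)\<^sup>2 + (Y w)\<^sup>2 + 2 * (X w * Y w))"
    using assms L2_integrable_mult[OF assms] by (simp add: L2_def)
  then show ?thesis
    using assms by (auto simp: L2_def power2_sum mult.assoc)
qed

context prob_space
begin

lemma L2_const: "(\<lambda>w. c) \<in> L2 M"
  by (simp add: L2_def)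

text \<open>Constants are square integrable under a probability measure, and \<open>X\<close> is its
  own product with the constant 1.\<close>

lemma L2_integrable: "X \<in> L2 M \<Longrightarrow> integrable M X"
  using L2_integrable_mult[OF L2_const[of 1]] by simp

lemma L2_affine_centred: "X \<in> L2 M \<Longrightarrow> (\<lambda>w. 1 - \<theta> * (X w - m)) \<in> L2 M"
  using L2_add[OF L2_const L2_scale[of X M "- \<theta>"], of "1 + \<theta> * m"]
  by (simp add: algebra_simps)

text \<open>When the square is expanded, \<open>expectation Z = 1\<close> turns the term linear in
  \<open>Z\<close> into a constant. The terms in \<open>X\<close> alone then combine to its mean and
  variance.\<close>

lemma penalised_expectation_eq:
  assumes X: "X \<in> L2 M" and Z: "Z \<in> L2 M" and Z1: "expectation Z = 1" and "\<theta> > 0"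
  shows "expectation (\<lambda>w. Z w * X w) + 1 / (2 * \<theta>) * (expectation (\<lambda>w. (Z w)\<^sup>2) - 1) =
    mean_variance M \<theta> X +
    1 / (2 * \<theta>) * expectation (\<lambda>w. (Z w - (1 - \<theta> * (X w - expectation X)))\<^sup>2)"
proof -
  define m where "m = expectation X"
  have [simp]: "integrable M X" "integrable M Z" "integrable M (\<lambda>w. (X w)\<^sup>2)"
      "integrable M (\<lambda>w. (Z w)\<^sup>2)" "integrable M (\<lambda>w. Z w * X w)"
    using X Z L2_integrable L2_integrable_square L2_integrable_mult by auto
  have sq: "(Z w - (1 - \<theta> * (X w - m)))\<^sup>2 =
      (Z w)\<^sup>2 + \<theta>\<^sup>2 * (X w)\<^sup>2 + 2 * \<theta> * (Z w * X w) - 2 * (1 + \<theta> * m) * Z w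
      - 2 * \<theta> * (1 + \<theta> * m) * X w + (1 + \<theta> * m)\<^sup>2" for w
    by (simp add: power2_eq_square algebra_simps)
  have E: "expectation (\<lambda>w. (Z w - (1 - \<theta> * (X w - m)))\<^sup>2) =
      expectation (\<lambda>w. (Z w)\<^sup>2) + \<theta>\<^sup>2 * expectation (\<lambda>w. (X w)\<^sup>2) +
      2 * \<theta> * expectation (\<lambda>w. Z w * X w) - 2 * (1 + \<theta> * m)
      - 2 * \<theta> * (1 + \<theta> * m) * m + (1 + \<theta> * m)\<^sup>2"
    unfolding sq by (simp add: Z1 prob_space flip: m_def)
  have V: "expectation (\<lambda>w. (X w - m)\<^sup>2) = expectation (\<lambda>w. (X w)\<^sup>2) - m\<^sup>2"
    by (simp add: variance_eq m_def)
  show ?thesis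
    unfolding mean_variance_def m_def[symmetric] V E
    using \<open>\<theta> > 0\<close> by (simp add: field_simps power2_eq_square)
qed

lemma Delta2_density:
  assumes "Q \<in> Delta2 M"
  obtains Z where "Z \<in> L2 M" "\<And>w. 0 \<le> Z w" "expectation Z = 1"
    "\<And>X. X \<in> borel_measurable M \<Longrightarrow>
      prob_space.expectation Q X = expectation (\<lambda>w. Z w * X w)"
    "enn2real (density_second_moment M Q) = expectation (\<lambda>w. (Z w)\<^sup>2)"
proof -
  from assms have Q: "prob_space Q" "sets Q = sets M" "absolutely_continuous M Q"
    and fin: "density_second_moment M Q < \<infinity>"
    by (auto simp: Delta2_def)
  interpret Q: prob_space Q by fact
  \<comment> \<open>\<open>enn2real\<close> sends infinity to 0, so \<open>Z\<close> is real and
    nonnegative everywhere, while it matches the derivative only almost everywhere.\<close>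
  define Z where "Z = (\<lambda>w. enn2real (RN_deriv M Q w))"
  have [measurable]: "Z \<in> borel_measurable M"
    by (simp add: Z_def)
  have "AE w in M. RN_deriv M Q w \<noteq> \<infinity>"
    by (rule RN_deriv_finite) (use Q Q.sigma_finite_measure in auto)
  then have fin_ae: "AE w in M. RN_deriv M Q w = ennreal (Z w)"
    by eventually_elim (auto simp: Z_def ennreal_enn2real_if)
  have "density M (RN_deriv M Q) = density M (\<lambda>w. ennreal (Z w))"
    using fin_ae by (intro density_cong) auto
  then have Q_eq: "Q = density M (\<lambda>w. ennreal (Z w))"
    using density_RN_deriv[OF Q(3,2)] by simp
  have nonneg: "0 \<le> Z w" for w
    by (simp add: Z_def)
  \<comment> \<open>If \<open>X\<close> is not integrable under \<open>Q\<close>, both sides take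
    the default value 0.\<close>
  have exp: "integral\<^sup>L Q X = expectation (\<lambda>w. Z w * X w)" if "X \<in> borel_measurable M" for X :: "'a \<Rightarrow> real"
    unfolding Q_eq using that by (subst integral_density) (auto simp: nonneg)
  have moment: "density_second_moment M Q = (\<integral>\<^sup>+w. ennreal ((Z w)\<^sup>2) \<partial>M)"
    unfolding density_second_moment_def
    by (rule nn_integral_cong_AE, use fin_ae in eventually_elim)
      (simp add: ennreal_power nonneg)
  have sq: "integrable M (\<lambda>w. (Z w)\<^sup>2)"
    using fin by (intro integrableI_nonneg) (auto simp: moment)
  show thesis
  proof
    show "Z \<in> L2 M" using sq by (simp add: L2_def)
    show "expectation Z = 1" using exp[of "\<lambda>_. 1"] Q.prob_space by simp
    show "enn2real (density_second_moment M Q) = expectation (\<lambda>w. (Z w)\<^sup>2)"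
      unfolding moment by (simp add: integral_eq_nn_integral)
  qed (use nonneg exp in auto)
qed

text \<open>The converse passage, from densities to measures. It provides the test measure that
  bounds the infimum from above.\<close>

lemma density_Delta2:
  assumes Z: "Z \<in> L2_plus M" and Z1: "expectation Z = 1"
  defines "Q \<equiv> density M (\<lambda>w. ennreal (Z w))"
  shows "Q \<in> Delta2 M"
    and "X \<in> borel_measurable M \<Longrightarrow>
      prob_space.expectation Q X = expectation (\<lambda>w. Z w * X w)"
    and "enn2real (density_second_moment M Q) = expectation (\<lambda>w. (Z w)\<^sup>2)"
proof -
  have L2: "Z \<in> L2 M" and nonneg: "AE w in M. 0 \<le> Z w"
    using Z by (auto simp: L2_plus_def)
  note [measurable] = L2_measurable[OF L2]
  \<comment> \<open>The second moment is defined through \<open>RN_deriv\<close>, so uniqueness has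
    to identify that function with \<open>Z\<close>. Since \<open>ennreal\<close> cuts negative
    values to 0, \<open>nonneg\<close> is used as well.\<close>
  have RN: "AE w in M. ennreal (Z w) = RN_deriv M Q w"
    by (rule RN_deriv_unique) (auto simp: Q_def)
  have moment: "density_second_moment M Q = (\<integral>\<^sup>+w. ennreal ((Z w)\<^sup>2) \<partial>M)"
    unfolding density_second_moment_def
    by (rule nn_integral_cong_AE, use RN nonneg in eventually_elim)
      (metis ennreal_power)
  have "emeasure Q (space Q) = ennreal (expectation Z)"
    using nonneg L2_integrable[OF L2]
    by (simp add: Q_def emeasure_density nn_integral_eq_integral cong: nn_integral_cong)
  then have "prob_space Q"
    using Z1 by (intro prob_spaceI) simp
  moreover have "absolutely_continuous M Q"
    unfolding Q_def by (rule absolutely_continuousI_density) simp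
  moreover have "density_second_moment M Q < \<infinity>"
    using L2_integrable_square[OF L2] unfolding moment
    by (simp add: nn_integral_eq_integral)
  ultimately show "Q \<in> Delta2 M"
    by (simp add: Delta2_def Q_def)
  show "prob_space.expectation Q X = expectation (\<lambda>w. Z w * X w)" if "X \<in> borel_measurable M"
    unfolding Q_def using that nonneg by (subst integral_density) auto
  show "enn2real (density_second_moment M Q) = expectation (\<lambda>w. (Z w)\<^sup>2)"
    unfolding moment by (simp add: integral_eq_nn_integral)
qed

text \<open>Every density satisfies \<open>Z \<ge> 0\<close>. Where \<open>W\<close> is negative,
  \<open>Z - W\<close> is therefore at least \<open>- W\<close>; elsewhere the negative part of
  \<open>W\<close> is 0. This bounds the remainder of the completed square uniformly in
  \<open>Q\<close>.\<close>

lemma monotone_mean_variance_ge: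
  assumes X: "X \<in> L2 M" and "\<theta> > 0"
  shows "ereal (mean_variance M \<theta> X + 1 / (2 * \<theta>) *
      expectation (\<lambda>w. (max 0 (- (1 - \<theta> * (X w - expectation X))))\<^sup>2))
    \<le> monotone_mean_variance M \<theta> X"
  unfolding monotone_mean_variance_def
proof (rule INF_greatest)
  fix Q assume "Q \<in> Delta2 M"
  then obtain Z where Z: "Z \<in> L2 M" "\<And>w. 0 \<le> Z w" "expectation Z = 1"
    and exp_Q: "\<And>Y. Y \<in> borel_measurable M \<Longrightarrow>
      prob_space.expectation Q Y = expectation (\<lambda>w. Z w * Y w)"
    and moment: "enn2real (density_second_moment M Q) = expectation (\<lambda>w. (Z w)\<^sup>2)"
    by (rule Delta2_density) (rule that)
  note exp = exp_Q[OF L2_measurable[OF X]]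
  define W where "W = (\<lambda>w. 1 - \<theta> * (X w - expectation X))"
  have W: "W \<in> L2 M"
    unfolding W_def using X by (rule L2_affine_centred)
  have le: "(max 0 (- W w))\<^sup>2 \<le> (Z w - W w)\<^sup>2" for w
  proof (cases "W w \<le> 0")
    case True
    then show ?thesis
      using Z(2)[of w] by (intro power_mono) auto
  qed auto
  have int: "integrable M (\<lambda>w. (Z w - W w)\<^sup>2)"
    using L2_integrable_square[OF L2_add[OF Z(1) L2_scale[OF W, of "- 1"]]] by simp
  have "expectation (\<lambda>w. (max 0 (- W w))\<^sup>2) \<le> expectation (\<lambda>w. (Z w - W w)\<^sup>2)"
    by (rule integral_mono'[OF int le]) simp
  then show "ereal (mean_variance M \<theta> X + 1 / (2 * \<theta>) *
      expectation (\<lambda>w. (max 0 (- (1 - \<theta> * (X w - expectation X))))\<^sup>2))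
    \<le> ereal (prob_space.expectation Q X +
        1 / (2 * \<theta>) * (enn2real (density_second_moment M Q) - 1))"
    unfolding exp moment penalised_expectation_eq[OF X Z(1,3) \<open>\<theta> > 0\<close>] W_def[symmetric]
    using \<open>\<theta> > 0\<close> by (simp add: W_def divide_right_mono)
qed

lemma mean_variance_le_monotone:
  assumes "X \<in> L2 M" "\<theta> > 0"
  shows "ereal (mean_variance M \<theta> X) \<le> monotone_mean_variance M \<theta> X"
  by (rule order_trans[OF _ monotone_mean_variance_ge[OF assms]]) (use \<open>\<theta> > 0\<close> in simp)

lemma mean_variance_less_monotone:
  assumes X: "X \<in> L2 M" and "\<theta> > 0"
    and neg: "(\<lambda>w. 1 - \<theta> * (X w - expectation X)) \<notin> L2_plus M"
  shows "ereal (mean_variance M \<theta> X) < monotone_mean_variance M \<theta> X"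
proof -
  define W where "W = (\<lambda>w. 1 - \<theta> * (X w - expectation X))"
  have W: "W \<in> L2 M"
    unfolding W_def using X by (rule L2_affine_centred)
  note [measurable] = L2_measurable[OF W]
  \<comment> \<open>Without integrability the integral could be 0 by default, which would say
    nothing about the sign of \<open>W\<close>.\<close>
  have int: "integrable M (\<lambda>w. (max 0 (- W w))\<^sup>2)"
    by (rule Bochner_Integration.integrable_bound[OF L2_integrable_square[OF W]])
      (auto simp: max_def)
  \<comment> \<open>As \<open>W\<close> is square integrable, it can fall outside
    \<open>L2_plus M\<close> only through its sign.\<close>
  have "\<not> (AE w in M. 0 \<le> W w)"
    using neg W by (simp add: L2_plus_def W_def)
  moreover have "(max 0 (- W w))\<^sup>2 = 0 \<longleftrightarrow> 0 \<le> W w" for w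
    by (auto simp: max_def)
  ultimately have "expectation (\<lambda>w. (max 0 (- W w))\<^sup>2) \<noteq> 0"
    using integral_nonneg_eq_0_iff_AE[OF int] by simp
  moreover have "0 \<le> expectation (\<lambda>w. (max 0 (- W w))\<^sup>2)"
    by simp
  ultimately have "0 < expectation (\<lambda>w. (max 0 (- W w))\<^sup>2)"
    by linarith
  with \<open>\<theta> > 0\<close> have "ereal (mean_variance M \<theta> X) <
      ereal (mean_variance M \<theta> X + 1 / (2 * \<theta>) * expectation (\<lambda>w. (max 0 (- W w))\<^sup>2))"
    by simp
  also have "\<dots> \<le> monotone_mean_variance M \<theta> X"
    unfolding W_def using X \<open>\<theta> > 0\<close> by (rule monotone_mean_variance_ge)
  finally show ?thesis .
qed

text \<open>\<open>W\<close> serves as the test density for \<open>X\<close>. Equal prices give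
  \<open>X\<close> the penalised expectation of \<open>Y\<close>, for which the remainder of the
  completed square vanishes.\<close>

lemma monotone_mean_variance_le_optimal:
  fixes Y :: "'a \<Rightarrow> real" and \<theta> :: real
  defines "W \<equiv> (\<lambda>w. 1 - \<theta> * (Y w - expectation Y))"
  assumes Y: "Y \<in> L2 M" and X: "X \<in> L2 M" and "\<theta> > 0" and W: "W \<in> L2_plus M"
    and price: "expectation (\<lambda>w. W w * X w) = expectation (\<lambda>w. W w * Y w)"
  shows "monotone_mean_variance M \<theta> X \<le> ereal (mean_variance M \<theta> Y)"
proof -
  have W1: "expectation W = 1"
    using L2_integrable[OF Y] by (simp add: W_def prob_space)
  define Q where "Q = density M (\<lambda>w. ennreal (W w))"
  note Q = density_Delta2[OF W W1, folded Q_def]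
  have "W \<in> L2 M" using W by (simp add: L2_plus_def)
  have "monotone_mean_variance M \<theta> X \<le> ereal (prob_space.expectation Q X +
        1 / (2 * \<theta>) * (enn2real (density_second_moment M Q) - 1))"
    unfolding monotone_mean_variance_def by (rule INF_lower[OF Q(1)])
  also have "prob_space.expectation Q X +
        1 / (2 * \<theta>) * (enn2real (density_second_moment M Q) - 1) =
      expectation (\<lambda>w. W w * Y w) + 1 / (2 * \<theta>) * (expectation (\<lambda>w. (W w)\<^sup>2) - 1)"
    by (simp add: Q(2)[OF L2_measurable[OF X]] Q(3) price)
  also have "\<dots> = mean_variance M \<theta> Y"
    unfolding penalised_expectation_eq[OF Y \<open>W \<in> L2 M\<close> W1 \<open>\<theta> > 0\<close>] by (simp add: W_def)
  finally show ?thesis .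
qed

end

theorem theorem2:
  fixes M :: "'a measure" and \<theta> :: real
    and A :: "('a \<Rightarrow> real) set" and Xstar :: "'a \<Rightarrow> real"
  assumes "prob_space M"
    and "\<theta> > 0"
    and "L2_closed M A"
    and "\<bar>SUP X\<in>A. ereal (mean_variance M \<theta> X)\<bar> \<noteq> \<infinity>"
    and "\<bar>SUP X\<in>A. monotone_mean_variance M \<theta> X\<bar> \<noteq> \<infinity>"
    and "Xstar \<in> A"
    and "ereal (mean_variance M \<theta> Xstar) = (SUP X\<in>A. ereal (mean_variance M \<theta> X))"
  shows "((\<exists>x0. (\<lambda>w. 1 - \<theta> * (Xstar w - prob_space.expectation M Xstar))
                  \<in> L2_plus M \<inter> discounting_measures M A x0) \<longrightarrow>
           (SUP X\<in>A. ereal (mean_variance M \<theta> X)) = (SUP X\<in>A. monotone_mean_variance M \<theta> X)) \<and>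
         ((\<lambda>w. 1 - \<theta> * (Xstar w - prob_space.expectation M Xstar)) \<notin> L2_plus M \<longrightarrow>
           (SUP X\<in>A. ereal (mean_variance M \<theta> X)) < (SUP X\<in>A. monotone_mean_variance M \<theta> X))"
proof -
  interpret prob_space M by fact
  have A: "X \<in> L2 M" if "X \<in> A" for X
    using that \<open>L2_closed M A\<close> by (auto simp: L2_closed_def)
  note Xstar = A[OF \<open>Xstar \<in> A\<close>]
  let ?W = "\<lambda>w. 1 - \<theta> * (Xstar w - expectation Xstar)"
  show ?thesis
  proof (intro conjI impI antisym)
    show "(SUP X\<in>A. ereal (mean_variance M \<theta> X)) \<le> (SUP X\<in>A. monotone_mean_variance M \<theta> X)"
      by (rule SUP_subset_mono) (simp_all add: mean_variance_le_monotone A \<open>\<theta> > 0\<close>)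
  next
    assume "\<exists>x0. ?W \<in> L2_plus M \<inter> discounting_measures M A x0"
    \<comment> \<open>Both \<open>X\<close> and \<open>Xstar\<close> lie in \<open>A\<close>, so the
      common price \<open>x0\<close> can be eliminated.\<close>
    then have W: "?W \<in> L2_plus M"
      and price: "expectation (\<lambda>w. ?W w * X w) = expectation (\<lambda>w. ?W w * Xstar w)"
        if "X \<in> A" for X
      using \<open>Xstar \<in> A\<close> that by (auto simp: discounting_measures_def)
    show "(SUP X\<in>A. monotone_mean_variance M \<theta> X) \<le> (SUP X\<in>A. ereal (mean_variance M \<theta> X))"
      \<comment> \<open>The supremum is attained at \<open>Xstar\<close>, so each wealth in
        \<open>A\<close> is compared with one fixed number.\<close>
      unfolding assms(7)[symmetric]
      by (rule SUP_least, rule monotone_mean_variance_le_optimal)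
        (use A Xstar W price \<open>\<theta> > 0\<close> in auto)
  next
    assume "?W \<notin> L2_plus M"
    then have "ereal (mean_variance M \<theta> Xstar) < monotone_mean_variance M \<theta> Xstar"
      using Xstar \<open>\<theta> > 0\<close> by (intro mean_variance_less_monotone)
    \<comment> \<open>The strict gap at \<open>Xstar\<close> passes to the suprema because the left
      one is attained there.\<close>
    also have "\<dots> \<le> (SUP X\<in>A. monotone_mean_variance M \<theta> X)"
      using \<open>Xstar \<in> A\<close> by (rule SUP_upper)
    finally show "(SUP X\<in>A. ereal (mean_variance M \<theta> X)) < (SUP X\<in>A. monotone_mean_variance M \<theta> X)"
      unfolding assms(7) .
  qed
qed

end
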